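(* For any abstract reduction system $\mathcal{A}=(A,\to_\mathcal{A})$, the greatest fixed point of the functional of $\mathrm{DVP}_\mathcal{A}$ equals the greatest fixed point of the functional of $\mathrm{DVP}'_\mathcal{A}$.
   Context: An abstract reduction system (ARS) is a pair $\mathcal{A}=(A,\to_\mathcal{A})$ of a set $A$ and a binary relation on $A$. $\mathrm{NF}_\mathcal{A}$ is the set of normal forms. $\Delta_\mathcal{A}(P)=\{t\in A\mid\exists s\in P.\ s\to_\mathcal{A}t\}$. $P\subseteq A$ is $\mathcal{A}$-runnable if $P\neq\emptyset$ and $P\cap\mathrm{NF}_\mathcal{A}=\emptyset$. An APR predicate over $A$ is a pair $P\Rightarrow Q$ with $P,Q\subseteq A$. For a set of inference rules over APR predicates, its functional maps a set $X$ of APR predicates to the set of conclusions of rule instances all of whose premises belong to $X$ and whose side conditions hold; the greatest fixed point is the largest $Y$ with $Y\subseteq$ functional$(Y)$. $\mathrm{DVP}_\mathcal{A}$ consists of: (Subsumption) no premises, conclusion $P\Rightarrow Q$, side condition $P\subseteq Q$; (Step) premise $\Delta_\mathcal{A}(P\setminus Q)\Rightarrow Q$, conclusion $P\Rightarrow Q$, side condition $P\setminus Q$ is $\mathcal{A}$-runnable. $\mathrm{DVP}'_\mathcal{A}$ consists of: (Axiom) no premises, conclusion $P\Rightarrow Q$, side condition $P=\emptyset$; (Subs) premises $P_1\Rightarrow Q,\dots,P_n\Rightarrow Q$, conclusion $P\Rightarrow Q$, side condition $P\cap Q\neq\emptyset$, where $P\setminus Q=P_1\cup\cdots\cup P_n$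 for some $n>0$ and, if $n>1$, $\emptyset\subsetneq P_i\subseteq P$ for all $i$; (Der) premises $P_1\Rightarrow Q,\dots,P_n\Rightarrow Q$, conclusion $P\Rightarrow Q$, side condition $P\cap Q=\emptyset$ and $P$ is $\mathcal{A}$-runnable, where $\Delta_\mathcal{A}(P)=P_1\cup\cdots\cup P_n$ for some $n>0$ and $P_i\neq\emptyset$ for all $i$. *)

theory Defs
  imports Main
begin

locale ars =
  fixes A :: "'a set" and R :: "'a rel"
  assumes rel_on_carrier: "R \<subseteq> A \<times> A"

definition normal_forms :: "'a set \<Rightarrow> 'a rel \<Rightarrow> 'a set" where
  "normal_forms A R = {s \<in> A. \<not> (\<exists>t \<in> A. (s, t) \<in> R)}"

definition derivatives :: "'a set \<Rightarrow> 'a rel \<Rightarrow> 'a set \<Rightarrow> 'a set" where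
  "derivatives A R P = {t \<in> A. \<exists>s \<in> P. (s, t) \<in> R}"

definition runnable :: "'a set \<Rightarrow> 'a rel \<Rightarrow> 'a set \<Rightarrow> bool" where
  "runnable A R P \<longleftrightarrow> P \<subseteq> A \<and> P \<noteq> {} \<and> P \<inter> normal_forms A R = {}"

text \<open>The pair \<open>(P, Q)\<close> stands for the all-path reachability predicate \<open>P \<Rightarrow> Q\<close>.\<close>

type_synonym 'a apr = "'a set \<times> 'a set"

definition apr_predicates :: "'a set \<Rightarrow> 'a apr set" where
  "apr_predicates A = {(P, Q). P \<subseteq> A \<and> Q \<subseteq> A}"

text \<open>A set of inference rules is given by its rule instances whose side conditions hold,
  as a relation between the list of premises and the conclusion. The predicates
  \<open>dvp\<close> and \<open>dvp'\<close> below are not recursive: they only enumerate rule instances.\<close>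

type_synonym 'a rules = "'a apr list \<Rightarrow> 'a apr \<Rightarrow> bool"

definition functional :: "'a rules \<Rightarrow> 'a apr set \<Rightarrow> 'a apr set" where
  "functional rules X = {c. \<exists>ps. rules ps c \<and> set ps \<subseteq> X}"

lemma mono_functional: "mono (functional rules)"
  unfolding functional_def by (rule monoI) blast

inductive dvp :: "'a set \<Rightarrow> 'a rel \<Rightarrow> 'a rules" for A :: "'a set" and R :: "'a rel" where
  Subsumption:
    "(P, Q) \<in> apr_predicates A \<Longrightarrow> P \<subseteq> Q
      \<Longrightarrow> dvp A R [] (P, Q)"
| Step:
    "(P, Q) \<in> apr_predicates A \<Longrightarrow> runnable A R (P - Q)
      \<Longrightarrow> dvp A R [(derivatives A R (P - Q), Q)] (P, Q)"

text \<open>In \<open>Subs\<close> and \<open>Der\<close> the list \<open>Ps\<close> is \<open>P\<^sub>1, \<dots>, P\<^sub>n\<close>; the \<open>P\<^sub>i\<close> need not be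
  disjoint. They are subsets of \<open>A\<close> because their union is.\<close>

inductive dvp' :: "'a set \<Rightarrow> 'a rel \<Rightarrow> 'a rules" for A :: "'a set" and R :: "'a rel" where
  Axiom:
    "(P, Q) \<in> apr_predicates A \<Longrightarrow> P = {}
      \<Longrightarrow> dvp' A R [] (P, Q)"
| Subs:
    "(P, Q) \<in> apr_predicates A \<Longrightarrow> P \<inter> Q \<noteq> {}
      \<Longrightarrow> P - Q = \<Union> (set Ps) \<Longrightarrow> length Ps > 0
      \<Longrightarrow> (length Ps > 1 \<Longrightarrow> \<forall>P' \<in> set Ps. {} \<subset> P' \<and> P' \<subseteq> P)
      \<Longrightarrow> dvp' A R (map (\<lambda>P'. (P', Q)) Ps) (P, Q)"
| Der:
    "(P, Q) \<in> apr_predicates A \<Longrightarrow> P \<inter> Q = {} \<Longrightarrow> runnable A R P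
      \<Longrightarrow> derivatives A R P = \<Union> (set Ps) \<Longrightarrow> length Ps > 0
      \<Longrightarrow> \<forall>P' \<in> set Ps. P' \<noteq> {}
      \<Longrightarrow> dvp' A R (map (\<lambda>P'. (P', Q)) Ps) (P, Q)"

end

theory Submission
  imports Defs
begin

text \<open>The greatest fixed point of \<open>DVP\<close> satisfies the rules of \<open>DVP'\<close> with the trivial
  one-element decompositions. Conversely, both the splitting in \<open>DVP'\<close> and the derivation steps
  act pointwise: the predicates \<open>P \<Rightarrow> Q\<close> such that each state of \<open>P\<close> lies in some \<open>P'\<close> with
  \<open>P' \<Rightarrow> Q\<close> derivable in \<open>DVP'\<close> are closed backwards under \<open>DVP\<close>.\<close>

lemma derivatives_nonempty:
  assumes "runnable A R P"
  shows "derivatives A R P \<noteq> {}"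
  using assms unfolding runnable_def normal_forms_def derivatives_def by blast

lemma functional_dvp_iff:
  "(P, Q) \<in> functional (dvp A R) X \<longleftrightarrow>
    (P, Q) \<in> apr_predicates A \<and>
    (P \<subseteq> Q \<or> runnable A R (P - Q) \<and> (derivatives A R (P - Q), Q) \<in> X)"
  unfolding functional_def dvp.simps by auto

lemma gfp_dvp_subset_gfp_dvp':
  "gfp (functional (dvp A R)) \<subseteq> gfp (functional (dvp' A R))"
proof (rule gfp_upperbound, rule subrelI)
  let ?X = "gfp (functional (dvp A R))"
  have unfold: "(P, Q) \<in> ?X \<longleftrightarrow> (P, Q) \<in> apr_predicates A \<and>
      (P \<subseteq> Q \<or> runnable A R (P - Q) \<and> (derivatives A R (P - Q), Q) \<in> ?X)" for P Q
    by (subst gfp_unfold[OF mono_functional]) (rule functional_dvp_iff)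
  fix P Q
  assume PQ: "(P, Q) \<in> ?X"
  then have apr: "(P, Q) \<in> apr_predicates A"
    using unfold by blast
  \<comment> \<open>The three cases select \<open>Axiom\<close>, \<open>Subs\<close> and
    \<open>Der\<close> respectively.\<close>
  consider "P = {}" | "P \<inter> Q \<noteq> {}" | "P \<noteq> {}" "P \<inter> Q = {}"
    by blast
  then have "\<exists>ps. dvp' A R ps (P, Q) \<and> set ps \<subseteq> ?X"
  proof cases
    case 1
    with apr show ?thesis
      using dvp'.Axiom[of P Q A R] by force
  next
    case 2
    have "(P - Q, Q) \<in> apr_predicates A"
      using apr unfolding apr_predicates_def by auto
    \<comment> \<open>Since \<open>(P - Q) - Q = P - Q\<close>, the two predicates have the same
      \<open>Step\<close> premise and the same runnability condition, and
      \<open>P - Q \<subseteq> Q\<close> is equivalent to \<open>P \<subseteq> Q\<close>.\<close>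
    with PQ have "(P - Q, Q) \<in> ?X"
      unfolding unfold[of P Q] unfolding unfold[of "P - Q" Q] by (simp add: Diff_subset_conv sup.absorb2)
    with 2 apr show ?thesis
      using dvp'.Subs[of P Q A "[P - Q]" R] by auto
  next
    case 3
    then have "P - Q = P" "\<not> P \<subseteq> Q"
      by auto
    with PQ have run: "runnable A R P" and der: "(derivatives A R P, Q) \<in> ?X"
      using unfold[of P Q] by auto
    \<comment> \<open>\<open>Der\<close> demands nonempty parts; a runnable set has at least one
      successor, so the single part qualifies.\<close>
    with 3 apr show ?thesis
      using dvp'.Der[of P Q A R "[derivatives A R P]"] derivatives_nonempty[OF run] by auto
  qed
  then show "(P, Q) \<in> functional (dvp' A R) ?X"
    unfolding functional_def by blast
qed

lemma gfp_dvp'_cases: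
  assumes "(P, Q) \<in> gfp (functional (dvp' A R))"
  obtains "P = {}"
  | Ps where "P \<inter> Q \<noteq> {}" "P - Q = \<Union> (set Ps)"
      "\<forall>P' \<in> set Ps. (P', Q) \<in> gfp (functional (dvp' A R))"
  | Ps where "P \<inter> Q = {}" "runnable A R P" "derivatives A R P = \<Union> (set Ps)"
      "\<forall>P' \<in> set Ps. (P', Q) \<in> gfp (functional (dvp' A R))"
proof -
  have "(P, Q) \<in> functional (dvp' A R) (gfp (functional (dvp' A R)))"
    using assms gfp_unfold[OF mono_functional] by blast
  then obtain ps where ps: "dvp' A R ps (P, Q)" "set ps \<subseteq> gfp (functional (dvp' A R))"
    unfolding functional_def by blast
  from ps(1) show ?thesis
  proof cases
    case Axiom
    then show ?thesis using that(1) by blast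
  next
    case (Subs Ps)
    with ps(2) have "\<forall>P' \<in> set Ps. (P', Q) \<in> gfp (functional (dvp' A R))"
      by (simp add: image_subset_iff)
    then show ?thesis
      by (rule that(2)[OF Subs(3,4)])
  next
    case (Der Ps)
    with ps(2) have "\<forall>P' \<in> set Ps. (P', Q) \<in> gfp (functional (dvp' A R))"
      by (simp add: image_subset_iff)
    then show ?thesis
      by (rule that(3)[OF Der(3-5)])
  qed
qed

lemma gfp_dvp'_apr:
  assumes "(P, Q) \<in> gfp (functional (dvp' A R))"
  shows "(P, Q) \<in> apr_predicates A"
proof -
  have "(P, Q) \<in> functional (dvp' A R) (gfp (functional (dvp' A R)))"
    using assms gfp_unfold[OF mono_functional] by blast
  then show ?thesis
    unfolding functional_def by (auto elim: dvp'.cases)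
qed

text \<open>At most one \<open>Subs\<close> precedes a \<open>Der\<close> on the way to
  \<open>s\<close>: the parts of \<open>P - Q\<close> avoid \<open>Q\<close>, so \<open>Subs\<close>
  cannot conclude the part that contains \<open>s\<close>. This \<open>P'\<close> is the set to
  which \<open>Der\<close> applies.\<close>

lemma gfp_dvp'_state:
  assumes PQ: "(P, Q) \<in> gfp (functional (dvp' A R))" and s: "s \<in> P" "s \<notin> Q"
  obtains P' Ps where "s \<in> P'" "runnable A R P'" "derivatives A R P' = \<Union> (set Ps)"
    "\<forall>P'' \<in> set Ps. (P'', Q) \<in> gfp (functional (dvp' A R))"
proof -
  note state = that
  \<comment> \<open>Here \<open>s \<in> P'\<close> excludes \<open>Axiom\<close> and disjointness
    from \<open>Q\<close> excludes \<open>Subs\<close>, which leaves \<open>Der\<close>.\<close>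
  have disjoint: thesis
    if P': "(P', Q) \<in> gfp (functional (dvp' A R))" "s \<in> P'" "P' \<inter> Q = {}" for P'
    using P'(1)
  proof (cases rule: gfp_dvp'_cases)
    case (3 Ps)
    with P' show ?thesis
      by (intro state)
  qed (use P' in auto)
  from PQ show ?thesis
  proof (cases rule: gfp_dvp'_cases)
    case (2 Ps)
    with s obtain P' where "P' \<in> set Ps" "s \<in> P'"
      by blast
    with 2 show ?thesis
      using disjoint[of P'] by blast
  next
    case (3 Ps)
    with s PQ show ?thesis
      by (intro disjoint)
  qed (use s in auto)
qed

lemma gfp_dvp'_subset_gfp_dvp:
  "gfp (functional (dvp' A R)) \<subseteq> gfp (functional (dvp A R))"
proof -
  let ?X = "gfp (functional (dvp' A R))"
  \<comment> \<open>The successors of \<open>P - Q\<close> may be covered by parts that stem from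
    different \<open>Der\<close> instances. \<open>Y\<close> is therefore built to be closed under
    unions and subsets of left-hand sides; the covering sets may reach outside
    \<open>P\<close>.\<close>
  define Y where "Y = {(P, Q) \<in> apr_predicates A. \<forall>s \<in> P. \<exists>P'. s \<in> P' \<and> (P', Q) \<in> ?X}"
  have "Y \<subseteq> functional (dvp A R) Y"
  proof (rule subrelI)
    fix P Q
    assume PQ: "(P, Q) \<in> Y"
    then have apr: "(P, Q) \<in> apr_predicates A"
      unfolding Y_def by blast
    have state: "\<exists>P' Ps. s \<in> P' \<and> runnable A R P' \<and> derivatives A R P' = \<Union> (set Ps) \<and>
        (\<forall>P'' \<in> set Ps. (P'', Q) \<in> ?X)" if "s \<in> P - Q" for s
    proof -
      from that PQ obtain P' where "(P', Q) \<in> ?X" "s \<in> P'" "s \<notin> Q"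
        unfolding Y_def by blast
      then show ?thesis
        by (elim gfp_dvp'_state) blast+
    qed
    \<comment> \<open>Each state of \<open>P - Q\<close> lies in some runnable set and so is not a
      normal form.\<close>
    have "runnable A R (P - Q)" if "\<not> P \<subseteq> Q"
      using state that apr unfolding runnable_def apr_predicates_def by blast
    moreover have "(derivatives A R (P - Q), Q) \<in> Y"
    proof -
      have "\<exists>P'. t \<in> P' \<and> (P', Q) \<in> ?X" if "t \<in> derivatives A R (P - Q)" for t
      proof -
        from that obtain s where s: "s \<in> P - Q" "(s, t) \<in> R" "t \<in> A"
          unfolding derivatives_def by blast
        from state[OF s(1)] obtain P' Ps where P': "s \<in> P'" "derivatives A R P' = \<Union> (set Ps)"
          "\<forall>P'' \<in> set Ps. (P'', Q) \<in> ?X"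
          by blast
        \<comment> \<open>A successor of \<open>s\<close> is a successor of \<open>P'\<close>, hence
          lies in one of the sets in \<open>Ps\<close>, which is the required cover of
          \<open>t\<close>.\<close>
        moreover from P'(1) s have "t \<in> derivatives A R P'"
          unfolding derivatives_def by blast
        ultimately show ?thesis
          by blast
      qed
      then show ?thesis
        using apr unfolding Y_def apr_predicates_def derivatives_def by auto
    qed
    ultimately show "(P, Q) \<in> functional (dvp A R) Y"
      using apr unfolding functional_dvp_iff by blast
  qed
  then have "Y \<subseteq> gfp (functional (dvp A R))"
    by (rule gfp_upperbound)
  \<comment> \<open>\<open>P\<close> itself covers each of its states.\<close>
  moreover have "?X \<subseteq> Y"
    unfolding Y_def using gfp_dvp'_apr by fast
  ultimately show ?thesis
    by blast
qed

theorem theorem8: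
  fixes A :: "'a set" and R :: "'a rel"
  assumes "ars A R"
  shows "gfp (functional (dvp A R)) = gfp (functional (dvp' A R))"
  using gfp_dvp_subset_gfp_dvp' gfp_dvp'_subset_gfp_dvp by (rule subset_antisym)

end
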